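(* Let $K$ be a finite simplicial complex and let $L\subseteq K$ be a non-empty subcomplex. Then $TC(K,L)=0$ if and only if $K$ is strongly collapsible.
   Context: Simplicial complexes are abstract simplicial complexes. The categorical product $K\prod L$ of simplicial complexes has vertex set $V(K)\times V(L)$, and a finite set $\sigma$ of vertices is a simplex iff its projections $p_1(\sigma)$ and $p_2(\sigma)$ are simplices of $K$ and $L$ respectively. Two simplicial maps $\phi,\psi:K\to M$ are contiguous, $\phi\sim_c\psi$, if $\phi(\sigma)\cup\psi(\sigma)$ is a simplex of $M$ for every simplex $\sigma$ of $K$. They are in the same contiguity class, $\phi\sim\psi$, if there is a finite sequence of simplicial maps $\phi=\phi_0\sim_c\phi_1\sim_c\cdots\sim_c\phi_n=\psi$. For a subcomplex $L\subseteq K$, the targeted simplicial complexity $TC(K,L)$ is the least integer $n\ge 0$ such that $K\prod L$ can be covered by $n+1$ subcomplexes $\Omega_0,\dots,\Omega_n$ such that for each $i$ there is a simplicial map $\sigma_i:\Omega_i\to L$ with $\Delta_L\circ\sigma_i\sim i_{\Omega_i}$, where $\Delta_L:L\to K\prod L$, $\Delta_L(v)=(v,v)$, and $i_{\Omega_i}:\Omega_i\to K\prod L$ is the inclusion. A simplicial complex $K$ is strongly collapsible if the identity map $id_K$ is in the same contiguity class as the constant map $c_v:K\to K$ for some vertex $v\in K$. *)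

theory Defs
  imports Main "HOL-Library.Extended_Nat"
begin

text \<open>A complex is represented by its set of simplices. Simplices are non-empty, so that a complex
  is non-empty iff it has a vertex.\<close>

definition abstract_simplicial_complex :: "'a set set \<Rightarrow> bool" where
  "abstract_simplicial_complex K \<longleftrightarrow>
     (\<forall>s\<in>K. finite s \<and> s \<noteq> {}) \<and> (\<forall>s\<in>K. \<forall>t. t \<subseteq> s \<longrightarrow> t \<noteq> {} \<longrightarrow> t \<in> K)"

definition vertex_set :: "'a set set \<Rightarrow> 'a set" where
  "vertex_set K = \<Union>K"

definition subcomplex :: "'a set set \<Rightarrow> 'a set set \<Rightarrow> bool" where
  "subcomplex L K \<longleftrightarrow> abstract_simplicial_complex L \<and> L \<subseteq> K"

definition categorical_product :: "'a set set \<Rightarrow> 'b set set \<Rightarrow> ('a \<times> 'b) set set" where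
  "categorical_product K L =
     {s. finite s \<and> s \<noteq> {} \<and> s \<subseteq> vertex_set K \<times> vertex_set L \<and> fst ` s \<in> K \<and> snd ` s \<in> L}"

text \<open>A simplicial map is given by a total function on the type of vertices. Only its values on
  \<open>vertex_set K\<close> matter, here and in the notions below: simplicial maps that agree on
  \<open>vertex_set K\<close> are contiguous.\<close>

definition simplicial_map :: "'a set set \<Rightarrow> 'b set set \<Rightarrow> ('a \<Rightarrow> 'b) \<Rightarrow> bool" where
  "simplicial_map K M f \<longleftrightarrow> (\<forall>s\<in>K. f ` s \<in> M)"

definition contiguous :: "'a set set \<Rightarrow> 'b set set \<Rightarrow> ('a \<Rightarrow> 'b) \<Rightarrow> ('a \<Rightarrow> 'b) \<Rightarrow> bool" where
  "contiguous K M f g \<longleftrightarrow>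
     simplicial_map K M f \<and> simplicial_map K M g \<and> (\<forall>s\<in>K. f ` s \<union> g ` s \<in> M)"

definition same_contiguity_class ::
    "'a set set \<Rightarrow> 'b set set \<Rightarrow> ('a \<Rightarrow> 'b) \<Rightarrow> ('a \<Rightarrow> 'b) \<Rightarrow> bool" where
  "same_contiguity_class K M f g \<longleftrightarrow>
     (\<exists>(n::nat) h. h 0 = f \<and> h n = g \<and> (\<forall>i\<le>n. simplicial_map K M (h i)) \<and>
        (\<forall>i<n. contiguous K M (h i) (h (Suc i))))"

definition diagonal :: "'a \<Rightarrow> 'a \<times> 'a" where
  "diagonal v = (v, v)"

definition TC_cover :: "'a set set \<Rightarrow> 'a set set \<Rightarrow> nat \<Rightarrow> bool" where
  "TC_cover K L n \<longleftrightarrow>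
     (\<exists>\<Omega> :: nat \<Rightarrow> ('a \<times> 'a) set set.
        (\<forall>i\<le>n. subcomplex (\<Omega> i) (categorical_product K L)) \<and>
        (\<Union>i\<le>n. \<Omega> i) = categorical_product K L \<and>
        (\<forall>i\<le>n. \<exists>\<sigma>. simplicial_map (\<Omega> i) L \<sigma> \<and>
           same_contiguity_class (\<Omega> i) (categorical_product K L) (diagonal \<circ> \<sigma>) id))"

text \<open>The value is \<open>\<infinity>\<close> if there is no such cover for any \<open>n\<close>, which happens for instance
  when \<open>K\<close> is disconnected and \<open>L\<close> is non-empty.\<close>

definition TC :: "'a set set \<Rightarrow> 'a set set \<Rightarrow> enat" where
  "TC K L = Inf {enat n | n. TC_cover K L n}"

definition strongly_collapsible :: "'a set set \<Rightarrow> bool" where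
  "strongly_collapsible K \<longleftrightarrow>
     (\<exists>v\<in>vertex_set K. same_contiguity_class K K id (\<lambda>_. v))"

end

theory Submission
  imports Defs
begin

text \<open>Since \<open>TC K L = 0\<close> means that the whole of \<open>K \<Prod> L\<close> serves as the only member of a cover,
  the claim compares the contraction of \<open>K\<close> with a single map \<open>\<sigma> : K \<Prod> L \<rightarrow> L\<close> for which
  \<open>\<Delta> \<circ> \<sigma> \<sim> id\<close>.

  Given such a \<open>\<sigma>\<close>, fix a vertex \<open>w\<close> of \<open>L\<close> and restrict to the slice \<open>K \<times> {w}\<close>. The two coordinates
  of the chain from \<open>\<Delta> \<circ> \<sigma>\<close> to \<open>id\<close> are chains of maps from \<open>K\<close> to \<open>K\<close> which both start at
  \<open>x \<mapsto> \<sigma> (x, w)\<close>; one ends at the identity of \<open>K\<close> and the other at the constant map with value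
  \<open>w\<close>. Joining them contracts \<open>K\<close> to \<open>w\<close>.

  Conversely, if \<open>id \<sim> c\<^sub>v\<close> on \<open>K\<close>, then any two simplicial maps into \<open>K\<close> are in the same contiguity
  class, as both are in the class of a constant map. In particular the two projections
  \<open>K \<Prod> L \<rightarrow> K\<close> are. Taking \<open>\<sigma>\<close> to be the projection to \<open>L\<close>, one moves the first coordinate of
  \<open>\<Delta> (\<sigma> (x, y)) = (y, y)\<close> to \<open>x\<close> and leaves the second one in place. Only maps into
  \<open>K\<close> are deformed here, so this works even for an \<open>L\<close> that is not itself contractible.\<close>

section \<open>Contiguity classes\<close>

text \<open>Each simplicial map is contiguous to itself, so in a chain of positive length the requirement
  that every term be simplicial comes for free; only the trivial chain needs it as a separate
  condition. This reduces chains to the reflexive transitive closure and its induction rules.\<close>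

lemma same_contiguity_class_iff_rtranclp:
  "same_contiguity_class K M f g \<longleftrightarrow> simplicial_map K M f \<and> (contiguous K M)\<^sup>*\<^sup>* f g"
proof
  assume "same_contiguity_class K M f g"
  then show "simplicial_map K M f \<and> (contiguous K M)\<^sup>*\<^sup>* f g"
    unfolding same_contiguity_class_def rtranclp_power relpowp_fun_conv by blast
next
  assume R: "simplicial_map K M f \<and> (contiguous K M)\<^sup>*\<^sup>* f g"
  then obtain n h where h: "h 0 = f" "h n = g" "\<forall>i<n. contiguous K M (h i) (h (Suc i))"
    unfolding rtranclp_power relpowp_fun_conv by blast
  have "simplicial_map K M (h i)" if "i \<le> n" for i
  proof (cases i)
    case 0
    then show ?thesis using R h(1) by simp
  next
    case (Suc j)
    then show ?thesis using h(3) that by (auto simp: contiguous_def)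
  qed
  with h show "same_contiguity_class K M f g"
    unfolding same_contiguity_class_def by blast
qed

lemma same_contiguity_class_sym:
  assumes "same_contiguity_class K M f g"
  shows "same_contiguity_class K M g f"
proof -
  have f: "simplicial_map K M f" and "(contiguous K M)\<^sup>*\<^sup>* f g"
    using assms by (auto simp: same_contiguity_class_iff_rtranclp)
  from this(2) f have "simplicial_map K M g"
    by cases (auto simp: contiguous_def)
  moreover have "symp (contiguous K M)"
    by (auto simp: symp_def contiguous_def Un_commute)
  then have "(contiguous K M)\<^sup>*\<^sup>* g f"
    using \<open>(contiguous K M)\<^sup>*\<^sup>* f g\<close> by (metis symp_rtranclp sympD)
  ultimately show ?thesis
    by (simp add: same_contiguity_class_iff_rtranclp)
qed

lemma same_contiguity_class_trans:
  "same_contiguity_class K M f g \<Longrightarrow> same_contiguity_class K M g h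
    \<Longrightarrow> same_contiguity_class K M f h"
  by (auto simp: same_contiguity_class_iff_rtranclp)

text \<open>Composition and pairing of maps preserve contiguity one step at a time. Since a map
  is contiguous to itself iff it is simplicial, the hypothesis on single steps also covers the
  trivial chain.\<close>

lemma same_contiguity_class_transport:
  assumes step: "\<And>a b. contiguous K M a b \<Longrightarrow> contiguous K' M' (F a) (F b)"
    and "same_contiguity_class K M f g"
  shows "same_contiguity_class K' M' (F f) (F g)"
proof -
  have f: "simplicial_map K M f" and chain: "(contiguous K M)\<^sup>*\<^sup>* f g"
    using assms(2) by (auto simp: same_contiguity_class_iff_rtranclp)
  have "contiguous K M f f"
    using f by (auto simp: contiguous_def simplicial_map_def)
  then have "simplicial_map K' M' (F f)"
    using step unfolding contiguous_def by blast
  moreover from chain have "(contiguous K' M')\<^sup>*\<^sup>* (F f) (F g)"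
    by induction (auto intro: rtranclp.rtrancl_into_rtrancl step)
  ultimately show ?thesis
    by (simp add: same_contiguity_class_iff_rtranclp)
qed

lemma same_contiguity_class_precompose:
  assumes "simplicial_map K' K p" and "same_contiguity_class K M f g"
  shows "same_contiguity_class K' M (f \<circ> p) (g \<circ> p)"
proof (rule same_contiguity_class_transport[where F = "\<lambda>a. a \<circ> p", OF _ assms(2)])
  fix a b assume "contiguous K M a b"
  then show "contiguous K' M (a \<circ> p) (b \<circ> p)"
    using assms(1) unfolding contiguous_def simplicial_map_def image_comp[symmetric] by blast
qed

lemma same_contiguity_class_postcompose:
  assumes "simplicial_map M M' q" and "same_contiguity_class K M f g"
  shows "same_contiguity_class K M' (q \<circ> f) (q \<circ> g)"
proof (rule same_contiguity_class_transport[where F = "\<lambda>a. q \<circ> a", OF _ assms(2)])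
  fix a b assume "contiguous K M a b"
  then show "contiguous K M' (q \<circ> a) (q \<circ> b)"
    using assms(1)
    unfolding contiguous_def simplicial_map_def image_comp[symmetric] image_Un[symmetric] by blast
qed

text \<open>Precomposing a contraction \<open>id \<sim> c\<^sub>v\<close> with a map \<open>p\<close> gives \<open>p \<sim> c\<^sub>v\<close>, where the constant map no
  longer remembers \<open>p\<close>.\<close>

lemma same_contiguity_class_into_strongly_collapsible:
  assumes "strongly_collapsible K" "simplicial_map P K p" "simplicial_map P K q"
  shows "same_contiguity_class P K p q"
proof -
  obtain v where v: "same_contiguity_class K K id (\<lambda>_. v)"
    using assms(1) by (auto simp: strongly_collapsible_def)
  have "same_contiguity_class P K p (\<lambda>_. v)" "same_contiguity_class P K q (\<lambda>_. v)"
    using same_contiguity_class_precompose[OF assms(2) v]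
      same_contiguity_class_precompose[OF assms(3) v] by (simp_all add: comp_def)
  then show ?thesis
    by (blast intro: same_contiguity_class_sym same_contiguity_class_trans)
qed

section \<open>The categorical product\<close>

lemma simplicial_map_fst: "simplicial_map (categorical_product K L) K fst"
  and simplicial_map_snd: "simplicial_map (categorical_product K L) L snd"
  by (auto simp: simplicial_map_def categorical_product_def)

text \<open>A finite non-empty set of pairs is a simplex as soon as its projections are: these already
  force the pairs to consist of vertices.\<close>

lemma categorical_product_iff:
  "s \<in> categorical_product K L \<longleftrightarrow> finite s \<and> s \<noteq> {} \<and> fst ` s \<in> K \<and> snd ` s \<in> L"
proof -
  have "s \<subseteq> vertex_set K \<times> vertex_set L" if "fst ` s \<in> K" "snd ` s \<in> L"
    using UnionI[OF that(1) imageI] UnionI[OF that(2) imageI]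
    by (auto simp: vertex_set_def mem_Times_iff)
  then show ?thesis
    by (auto simp: categorical_product_def)
qed

lemma abstract_simplicial_complex_face:
  "abstract_simplicial_complex K \<Longrightarrow> s \<in> K \<Longrightarrow> t \<subseteq> s \<Longrightarrow> t \<noteq> {} \<Longrightarrow> t \<in> K"
  unfolding abstract_simplicial_complex_def by blast

lemma abstract_simplicial_complex_simplex:
  assumes "abstract_simplicial_complex K" "s \<in> K"
  shows "finite s" "s \<noteq> {}"
  using assms unfolding abstract_simplicial_complex_def by blast+

lemma abstract_simplicial_complex_categorical_product:
  assumes "abstract_simplicial_complex K" "abstract_simplicial_complex L"
  shows "abstract_simplicial_complex (categorical_product K L)"
  unfolding abstract_simplicial_complex_def
proof (intro conjI ballI allI impI)
  fix s t assume s: "s \<in> categorical_product K L" and t: "t \<subseteq> s" "t \<noteq> {}"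
  have "fst ` t \<in> K"
    by (rule abstract_simplicial_complex_face[OF assms(1), of "fst ` s"])
      (use s t in \<open>auto simp: categorical_product_iff\<close>)
  moreover have "snd ` t \<in> L"
    by (rule abstract_simplicial_complex_face[OF assms(2), of "snd ` s"])
      (use s t in \<open>auto simp: categorical_product_iff\<close>)
  ultimately show "t \<in> categorical_product K L"
    using s t finite_subset[OF t(1)] by (simp add: categorical_product_iff)
qed (auto simp: categorical_product_iff)

lemma same_contiguity_class_pair:
  assumes "abstract_simplicial_complex P" "simplicial_map P L q"
    and "same_contiguity_class P K f g"
  shows "same_contiguity_class P (categorical_product K L) (\<lambda>x. (f x, q x)) (\<lambda>x. (g x, q x))"
proof (rule same_contiguity_class_transport[where F = "\<lambda>a x. (a x, q x)", OF _ assms(3)])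
  fix a b assume "contiguous P K a b"
  then have ab: "a ` s \<in> K" "b ` s \<in> K" "a ` s \<union> b ` s \<in> K" if "s \<in> P" for s
    using that by (auto simp: contiguous_def simplicial_map_def)
  have P: "finite s" "s \<noteq> {}" "q ` s \<in> L" if "s \<in> P" for s
    using abstract_simplicial_complex_simplex[OF assms(1) that] assms(2) that
    by (simp_all add: simplicial_map_def)
  show "contiguous P (categorical_product K L) (\<lambda>x. (a x, q x)) (\<lambda>x. (b x, q x))"
    unfolding contiguous_def simplicial_map_def categorical_product_iff
    by (simp add: ab P image_Un image_image)
qed

section \<open>Complexity zero\<close>

lemma TC_eq_0_iff: "TC K L = 0 \<longleftrightarrow> TC_cover K L 0"
proof
  assume *: "TC K L = 0"
  let ?A = "{enat n | n. TC_cover K L n}"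
  have "?A \<noteq> {}"
  proof
    assume "?A = {}"
    then have "TC K L = \<infinity>"
      unfolding TC_def by (simp only: Inf_enat_def refl if_True)
    then show False
      using * by simp
  qed
  \<comment> \<open>The extended naturals are well-ordered, so the infimum is attained.\<close>
  then obtain x where "x \<in> ?A"
    by blast
  then have "(LEAST x. x \<in> ?A) \<in> ?A"
    by (rule LeastI)
  then have "Inf ?A \<in> ?A"
    using \<open>?A \<noteq> {}\<close> by (simp only: Inf_enat_def if_False)
  then show "TC_cover K L 0"
    using * by (auto simp: TC_def zero_enat_def)
next
  assume "TC_cover K L 0"
  then have "TC K L \<le> enat 0"
    unfolding TC_def by (intro Inf_lower) auto
  then show "TC K L = 0"
    by (simp add: zero_enat_def[symmetric])
qed

lemma TC_cover_0_iff:
  assumes "abstract_simplicial_complex K" "abstract_simplicial_complex L"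
  shows "TC_cover K L 0 \<longleftrightarrow>
    (\<exists>\<sigma>. simplicial_map (categorical_product K L) L \<sigma> \<and>
      same_contiguity_class (categorical_product K L) (categorical_product K L)
        (diagonal \<circ> \<sigma>) id)"
  (is "_ \<longleftrightarrow> ?R")
proof
  assume ?R
  moreover have "subcomplex (categorical_product K L) (categorical_product K L)"
    using assms by (simp add: subcomplex_def abstract_simplicial_complex_categorical_product)
  ultimately show "TC_cover K L 0"
    unfolding TC_cover_def by (intro exI[of _ "\<lambda>_. categorical_product K L"]) auto
qed (auto simp: TC_cover_def)

theorem proposition4p5:
  fixes K L :: "'a set set"
  assumes "abstract_simplicial_complex K"
    and "finite K"
    and "subcomplex L K"
    and "L \<noteq> {}"
  shows "TC K L = 0 \<longleftrightarrow> strongly_collapsible K"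
proof -
  let ?P = "categorical_product K L"
  have L: "abstract_simplicial_complex L" and LK: "L \<subseteq> K"
    using assms(3) by (auto simp: subcomplex_def)
  have snd_K: "simplicial_map ?P K snd"
    using simplicial_map_snd[of K L] LK by (auto simp: simplicial_map_def)
  have "(\<exists>\<sigma>. simplicial_map ?P L \<sigma> \<and> same_contiguity_class ?P ?P (diagonal \<circ> \<sigma>) id)
    \<longleftrightarrow> strongly_collapsible K"
  proof
    assume "\<exists>\<sigma>. simplicial_map ?P L \<sigma> \<and> same_contiguity_class ?P ?P (diagonal \<circ> \<sigma>) id"
    then obtain \<sigma> where \<sigma>: "same_contiguity_class ?P ?P (diagonal \<circ> \<sigma>) id"
      by blast
    obtain w where w: "{w} \<in> L"
    proof -
      obtain t where t: "t \<in> L"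
        using assms(4) by blast
      then obtain w where "w \<in> t"
        using abstract_simplicial_complex_simplex(2)[OF L] by blast
      then show thesis
        using that abstract_simplicial_complex_face[OF L t, of "{w}"] by simp
    qed
    let ?slice = "\<lambda>x. (x, w)"
    have slice: "simplicial_map K ?P ?slice"
      using w
      by (simp add: simplicial_map_def categorical_product_iff image_image image_constant_conv
          abstract_simplicial_complex_simplex[OF assms(1)])
    have "same_contiguity_class K K (fst \<circ> (diagonal \<circ> \<sigma>) \<circ> ?slice) (fst \<circ> id \<circ> ?slice)"
      by (intro same_contiguity_class_precompose[OF slice]
          same_contiguity_class_postcompose[OF simplicial_map_fst \<sigma>])
    then have id: "same_contiguity_class K K (\<lambda>x. \<sigma> (x, w)) id"
      by (simp add: comp_def diagonal_def id_def)
    have "same_contiguity_class K K (snd \<circ> (diagonal \<circ> \<sigma>) \<circ> ?slice) (snd \<circ> id \<circ> ?slice)"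
      by (intro same_contiguity_class_precompose[OF slice]
          same_contiguity_class_postcompose[OF snd_K \<sigma>])
    then have const: "same_contiguity_class K K (\<lambda>x. \<sigma> (x, w)) (\<lambda>_. w)"
      by (simp add: comp_def diagonal_def)
    have "same_contiguity_class K K id (\<lambda>_. w)"
      using same_contiguity_class_trans[OF same_contiguity_class_sym[OF id] const] .
    moreover have "w \<in> vertex_set K"
      using w LK by (auto simp: vertex_set_def)
    ultimately show "strongly_collapsible K"
      by (auto simp: strongly_collapsible_def)
  next
    assume "strongly_collapsible K"
    then have "same_contiguity_class ?P K snd fst"
      using snd_K simplicial_map_fst by (rule same_contiguity_class_into_strongly_collapsible)
    then have "same_contiguity_class ?P ?P (\<lambda>z. (snd z, snd z)) (\<lambda>z. (fst z, snd z))"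
      using abstract_simplicial_complex_categorical_product[OF assms(1) L] simplicial_map_snd
      by (intro same_contiguity_class_pair)
    then have "same_contiguity_class ?P ?P (diagonal \<circ> snd) id"
      by (simp add: comp_def diagonal_def id_def)
    then show "\<exists>\<sigma>. simplicial_map ?P L \<sigma> \<and> same_contiguity_class ?P ?P (diagonal \<circ> \<sigma>) id"
      using simplicial_map_snd by blast
  qed
  then show ?thesis
    by (simp add: TC_eq_0_iff TC_cover_0_iff[OF assms(1) L])
qed

end
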